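(* Let $(X_n)_{n\ge0}$ be up-down chains on finite pairwise disjoint sets $(\mathbb S_n)_{n\ge0}$ with $\mathbb S_0=\{\varnothing\}$, whose up- and down-steps satisfy $p^\uparrow_np^\downarrow_{n+1}=\beta_np^\downarrow_np^\uparrow_{n-1}+(1-\beta_n)\mathrm{Id}$ for $n\ge1$ with $\beta_n\in(0,1)$, and let $(c_n)_{n\ge0}$ be positive numbers with $c_{n-1}/c_n=\beta_n$ for $n\ge1$. Suppose that for every $n\ge1$ there are $r_n,s_n\in\mathbb S_n$ such that $M_n(s_n)>0$ and $n=\min\{m\ge0:p_n^m(r_n,s_n)>0\}$. Suppose moreover that $\sum_{n\ge0}\frac1{c_n}<\infty$ and that $(c_{n+1}-c_n)_{n\ge0}$ is an unbounded, nondecreasing sequence. Then $$\lim_{n\to\infty}\Delta_n(\lfloor c_nt\rfloor)=\lim_{n\to\infty}\Delta^*_n(t)=\sum_{i=0}^\infty e^{-tc_i}\prod_{\substack{j=0\\ j\ne i}}^\infty\frac{c_j}{c_j-c_i},\qquad t>0.$$ Moreover, for every $n\ge0$, $$\sum_{i=n+1}^\infty e^{-tc_i}\prod_{\substack{j=0\\ j\ne i}}^\infty\frac{c_j}{c_j-c_i}=o(e^{-tc_n}),\qquad t\to\infty.$$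
   Context: Here $p^\uparrow_n$ ($n\ge0$) is a stochastic matrix from $\mathbb S_n$ to $\mathbb S_{n+1}$, $p^\downarrow_n$ ($n\ge1$) a stochastic matrix from $\mathbb S_n$ to $\mathbb S_{n-1}$, $X_n$ is the Markov chain on $\mathbb S_n$ with transition matrix $p_n=p^\uparrow_np^\downarrow_{n+1}$ and transition operator $T_n$, and $M_n=(p^\uparrow_0\cdots p^\uparrow_{n-1})(\varnothing,\cdot)$ is its unique stationary distribution. The separation distances of $X_n$ and of its continuous-time variant with generator $c_n(T_n-I)$ are $$\Delta_n(m)=\max_{r,s\in\mathbb S_n,\ M_n(s)\ne0}\Big(1-\frac{p_n^m(r,s)}{M_n(s)}\Big),\qquad \Delta^*_n(t)=\sup_{r\in\mathbb S_n,\ f:\mathbb S_n\to(0,\infty)}\Big(1-\frac{(e^{tc_n(T_n-I)}f)(r)}{\int f\,dM_n}\Big).$$ *)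

theory Defs
  imports "HOL-Analysis.Analysis" "HOL-Library.Landau_Symbols"
begin

text \<open>A matrix from a finite set \<open>A\<close> to a finite set \<open>B\<close> is a function
  \<open>P :: 'a \<Rightarrow> 'a \<Rightarrow> real\<close> of which only the entries \<open>P r s\<close> with \<open>r \<in> A\<close>, \<open>s \<in> B\<close> matter.\<close>

definition stochastic_matrix :: "'a set \<Rightarrow> 'a set \<Rightarrow> ('a \<Rightarrow> 'a \<Rightarrow> real) \<Rightarrow> bool" where
  "stochastic_matrix A B P \<longleftrightarrow>
     (\<forall>r\<in>A. (\<forall>s\<in>B. 0 \<le> P r s) \<and> (\<Sum>s\<in>B. P r s) = 1)"

definition id_mat :: "'a \<Rightarrow> 'a \<Rightarrow> real" where
  "id_mat r s = (if r = s then 1 else 0)"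

text \<open>The product of a matrix with columns in \<open>A\<close> and a matrix with rows in \<open>A\<close>.\<close>

definition mat_mul :: "'a set \<Rightarrow> ('a \<Rightarrow> 'a \<Rightarrow> real) \<Rightarrow> ('a \<Rightarrow> 'a \<Rightarrow> real) \<Rightarrow> 'a \<Rightarrow> 'a \<Rightarrow> real" where
  "mat_mul A P Q r s = (\<Sum>u\<in>A. P r u * Q u s)"

primrec mat_pow :: "'a set \<Rightarrow> ('a \<Rightarrow> 'a \<Rightarrow> real) \<Rightarrow> nat \<Rightarrow> 'a \<Rightarrow> 'a \<Rightarrow> real" where
  "mat_pow A P 0 = id_mat"
| "mat_pow A P (Suc m) = mat_mul A (mat_pow A P m) P"

text \<open>In what follows \<open>S n\<close> is the \<open>n\<close>-th state space, \<open>up n\<close> is a matrix from \<open>S n\<close> to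
  \<open>S (Suc n)\<close> and \<open>down n\<close>, for \<open>n \<ge> 1\<close>, is a matrix from \<open>S n\<close> to \<open>S (n - 1)\<close>; \<open>down 0\<close> is
  never used.\<close>

definition trans_mat ::
  "(nat \<Rightarrow> 'a set) \<Rightarrow> (nat \<Rightarrow> 'a \<Rightarrow> 'a \<Rightarrow> real) \<Rightarrow> (nat \<Rightarrow> 'a \<Rightarrow> 'a \<Rightarrow> real) \<Rightarrow> nat \<Rightarrow> 'a \<Rightarrow> 'a \<Rightarrow> real" where
  "trans_mat S up down n = mat_mul (S (Suc n)) (up n) (down (Suc n))"

text \<open>The product \<open>up 0 \<cdots> up (n - 1)\<close>, a matrix from \<open>S 0\<close> to \<open>S n\<close>.\<close>

primrec up_prod :: "(nat \<Rightarrow> 'a set) \<Rightarrow> (nat \<Rightarrow> 'a \<Rightarrow> 'a \<Rightarrow> real) \<Rightarrow> nat \<Rightarrow> 'a \<Rightarrow> 'a \<Rightarrow> real" where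
  "up_prod S up 0 = id_mat"
| "up_prod S up (Suc n) = mat_mul (S n) (up_prod S up n) (up n)"

definition stat_dist ::
  "(nat \<Rightarrow> 'a set) \<Rightarrow> (nat \<Rightarrow> 'a \<Rightarrow> 'a \<Rightarrow> real) \<Rightarrow> 'a \<Rightarrow> nat \<Rightarrow> 'a \<Rightarrow> real" where
  "stat_dist S up e n s = up_prod S up n e s"

definition sep_dist ::
  "(nat \<Rightarrow> 'a set) \<Rightarrow> (nat \<Rightarrow> 'a \<Rightarrow> 'a \<Rightarrow> real) \<Rightarrow> (nat \<Rightarrow> 'a \<Rightarrow> 'a \<Rightarrow> real) \<Rightarrow> 'a \<Rightarrow> nat \<Rightarrow> nat \<Rightarrow> real" where
  "sep_dist S up down e n m =
     Max {1 - mat_pow (S n) (trans_mat S up down n) m r s / stat_dist S up e n s | r s.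
            r \<in> S n \<and> s \<in> S n \<and> stat_dist S up e n s \<noteq> 0}"

definition trans_op ::
  "(nat \<Rightarrow> 'a set) \<Rightarrow> (nat \<Rightarrow> 'a \<Rightarrow> 'a \<Rightarrow> real) \<Rightarrow> (nat \<Rightarrow> 'a \<Rightarrow> 'a \<Rightarrow> real) \<Rightarrow> nat
     \<Rightarrow> ('a \<Rightarrow> real) \<Rightarrow> 'a \<Rightarrow> real" where
  "trans_op S up down n f r = (\<Sum>s\<in>S n. trans_mat S up down n r s * f s)"

text \<open>The exponential series of an operator on functions, evaluated pointwise. It is only
  applied to operators on functions on the finite set \<open>S n\<close>, for which it always converges;
  the values of a function outside \<open>S n\<close> do not influence the result on \<open>S n\<close>.\<close>

definition op_exp :: "(('a \<Rightarrow> real) \<Rightarrow> 'a \<Rightarrow> real) \<Rightarrow> ('a \<Rightarrow> real) \<Rightarrow> 'a \<Rightarrow> real" where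
  "op_exp L f r = (\<Sum>k. (L ^^ k) f r / fact k)"

definition sep_dist_cont ::
  "(nat \<Rightarrow> 'a set) \<Rightarrow> (nat \<Rightarrow> 'a \<Rightarrow> 'a \<Rightarrow> real) \<Rightarrow> (nat \<Rightarrow> 'a \<Rightarrow> 'a \<Rightarrow> real) \<Rightarrow> 'a
     \<Rightarrow> (nat \<Rightarrow> real) \<Rightarrow> nat \<Rightarrow> real \<Rightarrow> real" where
  "sep_dist_cont S up down e c n t =
     Sup {1 - op_exp (\<lambda>g x. t * c n * (trans_op S up down n g x - g x)) f r
                / (\<Sum>s\<in>S n. f s * stat_dist S up e n s) | r f.
            r \<in> S n \<and> (\<forall>s\<in>S n. 0 < f s)}"

definition limit_factor :: "(nat \<Rightarrow> real) \<Rightarrow> nat \<Rightarrow> nat \<Rightarrow> real" where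
  "limit_factor c i j = (if j = i then 1 else c j / (c j - c i))"

definition limit_term :: "(nat \<Rightarrow> real) \<Rightarrow> real \<Rightarrow> nat \<Rightarrow> real" where
  "limit_term c t i = exp (- t * c i) * (\<Prod>j. limit_factor c i j)"

end

theory Submission
  imports Defs "HOL-Computational_Algebra.Polynomial" "HOL-Real_Asymp.Real_Asymp"
begin

text \<open>
  The commutation relation makes \<open>T\<^sub>n\<close> act on the stochastic matrices
  \<open>Q\<^sub>k = down n \<cdots> down (k + 1) up k \<cdots> up (n - 1)\<close> like a pure death chain:
  \<open>T\<^sub>n Q\<^sub>k\<^sub>+\<^sub>1 = (1 - c\<^sub>k / c\<^sub>n) Q\<^sub>k\<^sub>+\<^sub>1 + (c\<^sub>k / c\<^sub>n) Q\<^sub>k\<close>, where \<open>Q\<^sub>n = I\<close> and every row of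
  \<open>Q\<^sub>0\<close> is \<open>M\<^sub>n\<close>. Hence \<open>T\<^sub>n\<^sup>m = T\<^sub>n\<^sup>m Q\<^sub>n\<close> dominates \<open>Q\<^sub>0\<close> times the probability that the death
  chain started at \<open>n\<close> is absorbed at \<open>0\<close> by time \<open>m\<close>, with equality at \<open>(r\<^sub>n, s\<^sub>n)\<close>, because
  \<open>Q\<^sub>k\<close> is a polynomial of degree \<open>n - k\<close> in \<open>T\<^sub>n\<close> and so vanishes there for \<open>k \<ge> 1\<close>. The
  separation distance is thus the tail of a sum of independent geometric variables or, in
  continuous time, by Poissonization, of exponential variables with rates \<open>c\<^sub>0, \<dots>, c\<^sub>n\<^sub>-\<^sub>1\<close>.
  The resulting finite sums converge by Tannery's theorem: convexity of \<open>c\<close> bounds the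
  products by \<open>C exp (\<delta> c\<^sub>i)\<close>, uniformly in \<open>n\<close>, for every \<open>\<delta> > 0\<close>.
\<close>

subsection \<open>Matrices indexed by sets\<close>

lemma mat_mul_assoc: "mat_mul B (mat_mul A P Q) R = mat_mul A P (mat_mul B Q R)"
proof (intro ext)
  fix r s
  have "(\<Sum>v\<in>B. (\<Sum>u\<in>A. P r u * Q u v) * R v s) = (\<Sum>u\<in>A. \<Sum>v\<in>B. P r u * Q u v * R v s)"
    by (subst sum.swap) (simp add: sum_distrib_right)
  then show "mat_mul B (mat_mul A P Q) R r s = mat_mul A P (mat_mul B Q R) r s"
    by (simp add: mat_mul_def sum_distrib_left mult.assoc)
qed

lemma mat_mul_id_left: "finite A \<Longrightarrow> r \<in> A \<Longrightarrow> mat_mul A id_mat P r s = P r s"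
  by (simp add: mat_mul_def id_mat_def if_distrib[of "\<lambda>x. x * _"] cong: if_cong)

lemma mat_mul_id_right: "finite A \<Longrightarrow> s \<in> A \<Longrightarrow> mat_mul A P id_mat r s = P r s"
  by (simp add: mat_mul_def id_mat_def if_distrib[of "\<lambda>x. _ * x"] cong: if_cong)

lemma mat_mul_cong:
  "(\<And>u. u \<in> A \<Longrightarrow> P r u = P' r u) \<Longrightarrow> (\<And>u. u \<in> A \<Longrightarrow> Q u s = Q' u s)
    \<Longrightarrow> mat_mul A P Q r s = mat_mul A P' Q' r s"
  by (simp add: mat_mul_def)

lemma mat_mul_add_left:
  "mat_mul A (\<lambda>r s. a * P r s + b * Q r s) R r s = a * mat_mul A P R r s + b * mat_mul A Q R r s"
  by (simp add: mat_mul_def sum.distrib sum_distrib_left algebra_simps)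

lemma mat_mul_add_right:
  "mat_mul A R (\<lambda>r s. a * P r s + b * Q r s) r s = a * mat_mul A R P r s + b * mat_mul A R Q r s"
  by (simp add: mat_mul_def sum.distrib sum_distrib_left algebra_simps)

text \<open>\<open>mat_pow\<close> appends factors on the right, whereas iterating the transition
  operator puts them on the left; \<open>op_exp_trans_op\<close> has to pass from one order to the
  other.\<close>

lemma mat_pow_commute:
  assumes "finite A" "r \<in> A" "s \<in> A"
  shows "mat_mul A P (mat_pow A P m) r s = mat_pow A P (Suc m) r s"
  using assms(2,3)
proof (induction m arbitrary: s)
  case 0
  then show ?case
    using assms(1) by (simp add: mat_mul_id_left mat_mul_id_right)
next
  case (Suc m)
  have "mat_mul A P (mat_pow A P (Suc m)) r s = mat_mul A (mat_mul A P (mat_pow A P m)) P r s"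
    by (simp add: mat_mul_assoc)
  also have "\<dots> = mat_mul A (mat_pow A P (Suc m)) P r s"
    using Suc by (intro mat_mul_cong) auto
  finally show ?case
    by simp
qed

lemma stochastic_matrix_nonneg:
  "stochastic_matrix A B P \<Longrightarrow> r \<in> A \<Longrightarrow> s \<in> B \<Longrightarrow> 0 \<le> P r s"
  by (simp add: stochastic_matrix_def)

lemma stochastic_matrix_sum: "stochastic_matrix A B P \<Longrightarrow> r \<in> A \<Longrightarrow> (\<Sum>s\<in>B. P r s) = 1"
  by (simp add: stochastic_matrix_def)

lemma stochastic_matrix_id: "finite A \<Longrightarrow> stochastic_matrix A A id_mat"
  by (simp add: stochastic_matrix_def id_mat_def)

lemma stochastic_matrix_mul:
  assumes "stochastic_matrix A B P" "stochastic_matrix B C Q"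
  shows "stochastic_matrix A C (mat_mul B P Q)"
proof -
  have "(\<Sum>s\<in>C. mat_mul B P Q r s) = 1" if "r \<in> A" for r
  proof -
    have "(\<Sum>s\<in>C. mat_mul B P Q r s) = (\<Sum>u\<in>B. P r u * (\<Sum>s\<in>C. Q u s))"
      unfolding mat_mul_def by (subst sum.swap) (simp add: sum_distrib_left)
    also have "\<dots> = (\<Sum>u\<in>B. P r u)"
      using stochastic_matrix_sum[OF assms(2)] by simp
    finally show ?thesis
      using stochastic_matrix_sum[OF assms(1) that] by simp
  qed
  moreover have "0 \<le> mat_mul B P Q r s" if "r \<in> A" "s \<in> C" for r s
    unfolding mat_mul_def using that
    by (intro sum_nonneg mult_nonneg_nonneg)
      (auto intro: stochastic_matrix_nonneg[OF assms(1)] stochastic_matrix_nonneg[OF assms(2)])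
  ultimately show ?thesis
    by (simp add: stochastic_matrix_def)
qed

lemma stochastic_matrix_pow:
  "finite A \<Longrightarrow> stochastic_matrix A A P \<Longrightarrow> stochastic_matrix A A (mat_pow A P m)"
  by (induction m) (simp_all add: stochastic_matrix_id stochastic_matrix_mul)

subsection \<open>Absorption times of pure death chains\<close>

text \<open>The Lagrange interpolation polynomial of the constant \<open>1\<close>, evaluated at \<open>0\<close>.\<close>

lemma lagrange_sum_eq_1:
  fixes c :: "nat \<Rightarrow> real"
  assumes "inj_on c {..<k}" "0 < k"
  shows "(\<Sum>i<k. \<Prod>j<k. limit_factor c i j) = 1"
proof -
  define l where
    "l i = (\<Prod>j\<in>{..<k} - {i}. [:- c j / (c i - c j), 1 / (c i - c j):])" for i
  have eq: "poly (l i) x = (\<Prod>j\<in>{..<k} - {i}. (x - c j) / (c i - c j))" for i x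
    by (simp add: l_def poly_prod diff_divide_distrib)
  have "degree (l i) \<le> k - 1" if "i < k" for i
  proof -
    have "degree (l i) \<le> (\<Sum>j\<in>{..<k} - {i}. degree [:- c j / (c i - c j), 1 / (c i - c j):])"
      unfolding l_def by (intro order.trans[OF degree_prod_sum_le]) (auto simp: o_def)
    also have "\<dots> \<le> (\<Sum>j\<in>{..<k} - {i}. 1)"
      by (intro sum_mono) simp
    finally show ?thesis
      using that by simp
  qed
  then have "degree (\<Sum>i<k. l i) \<le> k - 1"
    by (intro degree_sum_le) auto
  \<comment> \<open>The \<open>l i\<close> form the Lagrange basis at the \<open>k\<close> distinct
    nodes \<open>c j\<close>. Their sum has degree below \<open>k\<close>, so its values at the
    nodes determine it.\<close>
  moreover have "poly (\<Sum>i<k. l i) x = poly 1 x" if "x \<in> c ` {..<k}" for x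
  proof -
    obtain m where m: "m < k" "x = c m"
      using \<open>x \<in> c ` {..<k}\<close> by auto
    have "poly (l i) x = (if i = m then 1 else 0)" if "i < k" for i
    proof (cases "i = m")
      case True
      have "c m \<noteq> c j" if "j \<in> {..<k} - {m}" for j
        using assms(1) m that by (auto simp: inj_on_def)
      then show ?thesis
        by (simp add: eq True m)
    next
      case False
      then show ?thesis
        using m by (auto simp: eq intro!: prod_zero)
    qed
    then show ?thesis
      using m by (simp add: poly_sum)
  qed
  ultimately have "(\<Sum>i<k. l i) = 1"
    using assms by (intro poly_eqI_degree[of "c ` {..<k}"]) (auto simp: card_image)
  then have "(\<Sum>i<k. poly (l i) 0) = 1"
    by (metis poly_1 poly_sum)
  moreover have "poly (l i) 0 = (\<Prod>j<k. limit_factor c i j)" if "i < k" for i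
  proof -
    have "(\<Prod>j<k. limit_factor c i j) = (\<Prod>j\<in>{..<k} - {i}. limit_factor c i j)"
      using that by (subst prod.remove[of _ i]) (auto simp: limit_factor_def)
    also have "\<dots> = (\<Prod>j\<in>{..<k} - {i}. (0 - c j) / (c i - c j))"
      by (intro prod.cong) (auto simp: limit_factor_def minus_divide_right)
    finally show ?thesis
      by (simp add: eq)
  qed
  ultimately show ?thesis
    by simp
qed

text \<open>The probability that a sum of independent geometric variables with success probabilities
  \<open>c 0 / N, \<dots>, c (k - 1) / N\<close> exceeds \<open>m\<close>.\<close>

definition survival :: "(nat \<Rightarrow> real) \<Rightarrow> real \<Rightarrow> nat \<Rightarrow> nat \<Rightarrow> real" where
  "survival c N k m = (\<Sum>i<k. (1 - c i / N) ^ m * (\<Prod>j<k. limit_factor c i j))"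

lemma survival_level_0: "survival c N 0 m = 0"
  by (simp add: survival_def)

lemma survival_time_0: "inj_on c {..<k} \<Longrightarrow> 0 < k \<Longrightarrow> survival c N k 0 = 1"
  by (simp add: survival_def lagrange_sum_eq_1)

text \<open>First-step analysis of the death chain, verified summand by summand: for
  \<open>i < k\<close> the coefficients obey
  \<open>(c k - c i) * ?a (Suc k) i = c k * ?a k i\<close>, while the summand \<open>i = k\<close>
  exists only at level \<open>Suc k\<close> and is simply multiplied by
  \<open>1 - c k / N\<close>.\<close>

lemma survival_Suc:
  assumes "inj_on c {..<Suc k}" and "N \<noteq> 0"
  shows "survival c N (Suc k) (Suc m)
    = (1 - c k / N) * survival c N (Suc k) m + c k / N * survival c N k m"
proof -
  let ?a = "\<lambda>k i. \<Prod>j<k. limit_factor c i j"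
  have *: "(1 - c i / N) * ?a (Suc k) i = (1 - c k / N) * ?a (Suc k) i + c k / N * ?a k i"
    if "i < k" for i
  proof -
    have ne: "c k - c i \<noteq> 0"
      using inj_onD[OF assms(1), of k i] that by auto
    have "(c k - c i) * limit_factor c i k = c k"
      using ne that by (simp add: limit_factor_def)
    then have "(c k - c i) * ?a (Suc k) i = c k * ?a k i"
      by (metis mult.commute mult.left_commute prod.lessThan_Suc)
    then have "(c k - c i) * ?a (Suc k) i / N = c k * ?a k i / N"
      by simp
    then show ?thesis
      by (simp add: algebra_simps diff_divide_distrib del: prod.lessThan_Suc)
  qed
  have "(\<Sum>i<k. (1 - c i / N) ^ Suc m * ?a (Suc k) i)
      = (\<Sum>i<k. (1 - c i / N) ^ m * ((1 - c i / N) * ?a (Suc k) i))"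
    by (simp add: mult_ac)
  also have "\<dots> = (\<Sum>i<k. (1 - c i / N) ^ m * ((1 - c k / N) * ?a (Suc k) i + c k / N * ?a k i))"
    using * by (intro sum.cong) simp_all
  also have "\<dots> = (1 - c k / N) * (\<Sum>i<k. (1 - c i / N) ^ m * ?a (Suc k) i)
      + c k / N * (\<Sum>i<k. (1 - c i / N) ^ m * ?a k i)"
    unfolding sum_distrib_left sum.distrib[symmetric]
    by (intro sum.cong refl) (simp only: distrib_left mult_ac)
  finally show ?thesis
    unfolding survival_def sum.lessThan_Suc by (simp add: algebra_simps del: prod.lessThan_Suc)
qed

subsection \<open>Up-down chains\<close>

locale up_down_chain =
  fixes S :: "nat \<Rightarrow> 'a set"
    and up down :: "nat \<Rightarrow> 'a \<Rightarrow> 'a \<Rightarrow> real"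
    and e :: 'a
    and \<beta> c :: "nat \<Rightarrow> real"
  assumes finite_S: "finite (S n)"
    and S_0: "S 0 = {e}"
    and up: "stochastic_matrix (S n) (S (Suc n)) (up n)"
    and down: "n \<ge> 1 \<Longrightarrow> stochastic_matrix (S n) (S (n - 1)) (down n)"
    and \<beta>: "n \<ge> 1 \<Longrightarrow> 0 < \<beta> n \<and> \<beta> n < 1"
    and commutation: "n \<ge> 1 \<Longrightarrow> r \<in> S n \<Longrightarrow> s \<in> S n \<Longrightarrow>
      mat_mul (S (Suc n)) (up n) (down (Suc n)) r s
        = \<beta> n * mat_mul (S (n - 1)) (down n) (up (n - 1)) r s + (1 - \<beta> n) * id_mat r s"
    and c_pos: "0 < c n"
    and c_ratio: "n \<ge> 1 \<Longrightarrow> c (n - 1) / c n = \<beta> n"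
begin

abbreviation T :: "nat \<Rightarrow> 'a \<Rightarrow> 'a \<Rightarrow> real" where
  "T n \<equiv> trans_mat S up down n"

abbreviation Tpow :: "nat \<Rightarrow> nat \<Rightarrow> 'a \<Rightarrow> 'a \<Rightarrow> real" where
  "Tpow n m \<equiv> mat_pow (S n) (T n) m"

abbreviation M :: "nat \<Rightarrow> 'a \<Rightarrow> real" where
  "M n \<equiv> stat_dist S up e n"

lemma \<beta>_Suc: "\<beta> (Suc n) = c n / c (Suc n)"
  using c_ratio[of "Suc n"] by simp

lemma c_strict_mono: "strict_mono c"
proof (rule strict_monoI_Suc)
  fix n
  show "c n < c (Suc n)"
    using \<beta>[of "Suc n"] c_pos[of "Suc n"] by (simp add: \<beta>_Suc)
qed

lemma c_inj: "inj_on c X"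
  using c_strict_mono strict_mono_imp_inj_on inj_on_subset by blast

lemma stochastic_trans: "stochastic_matrix (S n) (S n) (T n)"
  unfolding trans_mat_def using stochastic_matrix_mul[OF up down[of "Suc n"]] by simp

lemma stochastic_Tpow: "stochastic_matrix (S n) (S n) (Tpow n m)"
  by (intro stochastic_matrix_pow finite_S stochastic_trans)

lemma stochastic_M: "stochastic_matrix (S 0) (S n) (\<lambda>_. M n)"
proof -
  have "stochastic_matrix (S 0) (S n) (up_prod S up n)"
    by (induction n) (simp_all add: stochastic_matrix_id stochastic_matrix_mul[OF _ up] finite_S)
  then show ?thesis
    by (simp add: S_0 stat_dist_def stochastic_matrix_def)
qed

lemma M_nonneg: "s \<in> S n \<Longrightarrow> 0 \<le> M n s"
  using stochastic_matrix_nonneg[OF stochastic_M] S_0 by blast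

lemma M_sum: "(\<Sum>s\<in>S n. M n s) = 1"
  using stochastic_matrix_sum[OF stochastic_M] S_0 by blast

text \<open>With \<open>D = down (Suc n)\<close> and \<open>U = up n\<close>, commutation makes
  \<open>T (Suc n)\<close> a mixture of \<open>D U\<close> and the identity, and regrouping gives
  \<open>(D U) (D X) = D (U D) X = D (T n) X\<close>.\<close>

lemma trans_down:
  assumes "r \<in> S (Suc n)"
  shows "mat_mul (S (Suc n)) (T (Suc n)) (mat_mul (S n) (down (Suc n)) X) r s
    = \<beta> (Suc n) * mat_mul (S n) (down (Suc n)) (mat_mul (S n) (T n) X) r s
      + (1 - \<beta> (Suc n)) * mat_mul (S n) (down (Suc n)) X r s"
proof -
  let ?DX = "mat_mul (S n) (down (Suc n)) X"
  let ?DU = "mat_mul (S n) (down (Suc n)) (up n)"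
  have "mat_mul (S (Suc n)) (T (Suc n)) ?DX r s
      = mat_mul (S (Suc n)) (\<lambda>r s. \<beta> (Suc n) * ?DU r s + (1 - \<beta> (Suc n)) * id_mat r s) ?DX r s"
    using commutation[of "Suc n" r] assms
    by (intro mat_mul_cong) (simp_all add: trans_mat_def)
  also have "\<dots> = \<beta> (Suc n) * mat_mul (S (Suc n)) ?DU ?DX r s + (1 - \<beta> (Suc n)) * ?DX r s"
    by (simp add: mat_mul_add_left mat_mul_id_left finite_S assms)
  also have "mat_mul (S (Suc n)) ?DU ?DX = mat_mul (S n) (down (Suc n)) (mat_mul (S n) (T n) X)"
    by (simp add: trans_mat_def mat_mul_assoc)
  finally show ?thesis .
qed

text \<open>In matrix notation, \<open>bridge n k = down n \<cdots> down (k + 1) up k \<cdots> up (n - 1)\<close>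
  for \<open>k \<le> n\<close>.\<close>

primrec bridge :: "nat \<Rightarrow> nat \<Rightarrow> 'a \<Rightarrow> 'a \<Rightarrow> real" where
  "bridge 0 k = id_mat"
| "bridge (Suc n) k = (if k = Suc n then id_mat
     else mat_mul (S n) (down (Suc n)) (mat_mul (S n) (bridge n k) (up n)))"

lemma bridge_self: "bridge n n = id_mat"
  by (cases n) simp_all

text \<open>Descending to the single point of \<open>S 0\<close> forgets the start: all rows at
  level \<open>n\<close> agree, so the stochastic \<open>down (Suc n)\<close> averages equal
  values.\<close>

lemma bridge_0: "r \<in> S n \<Longrightarrow> bridge n 0 r s = M n s"
proof (induction n arbitrary: r s)
  case 0
  then show ?case
    by (simp add: S_0 stat_dist_def)
next
  case (Suc n)
  have "bridge (Suc n) 0 r s = (\<Sum>u\<in>S n. down (Suc n) r u * mat_mul (S n) (up_prod S up n) (up n) e s)"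
    using Suc.IH by (simp add: mat_mul_def stat_dist_def)
  also have "\<dots> = mat_mul (S n) (up_prod S up n) (up n) e s"
    using stochastic_matrix_sum[OF down[of "Suc n"] Suc.prems]
    by (simp flip: sum_distrib_right)
  finally show ?case
    by (simp add: stat_dist_def)
qed

lemma bridge_nonneg: "r \<in> S n \<Longrightarrow> s \<in> S n \<Longrightarrow> 0 \<le> bridge n k r s"
proof (induction n arbitrary: r s)
  case 0
  then show ?case
    by (simp add: id_mat_def)
next
  case (Suc n)
  have "0 \<le> down (Suc n) r u" if "u \<in> S n" for u
    using stochastic_matrix_nonneg[OF down[of "Suc n"] Suc.prems(1)] that by simp
  moreover have "0 \<le> up n u s" if "u \<in> S n" for u
    using stochastic_matrix_nonneg[OF up that Suc.prems(2)] .
  ultimately show ?case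
    using Suc.IH by (auto simp: mat_mul_def id_mat_def intro!: sum_nonneg mult_nonneg_nonneg)
qed

text \<open>Induction on \<open>n\<close>. If \<open>k\<close> is one below the top, this is the
  commutation relation itself. Otherwise \<open>trans_down\<close> moves \<open>T\<close> past one
  \<open>down\<close>, and the factor \<open>\<beta> (Suc n) = c n / c (Suc n)\<close> turns the
  rate \<open>c k / c n\<close> into \<open>c k / c (Suc n)\<close>.\<close>

lemma trans_bridge:
  assumes "k < n" "r \<in> S n" "s \<in> S n"
  shows "mat_mul (S n) (T n) (bridge n (Suc k)) r s
    = (1 - c k / c n) * bridge n (Suc k) r s + c k / c n * bridge n k r s"
  using assms
proof (induction n arbitrary: r s)
  case 0
  then show ?case
    by simp
next
  case (Suc n)
  show ?case
  proof (cases "k = n")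
    case True
    have "bridge (Suc n) n r s = mat_mul (S n) (down (Suc n)) (up n) r s"
      by (simp add: bridge_self) (intro mat_mul_cong; simp add: mat_mul_id_left finite_S)
    then show ?thesis
      using commutation[of "Suc n" r s] Suc.prems
      by (simp add: True bridge_self mat_mul_id_right finite_S \<beta>_Suc trans_mat_def del: bridge.simps)
  next
    case False
    then have "k < n"
      using Suc.prems by simp
    let ?b = "\<beta> (Suc n)" and ?D = "down (Suc n)" and ?U = "up n"
    have b: "bridge (Suc n) (Suc k) = mat_mul (S n) ?D (mat_mul (S n) (bridge n (Suc k)) ?U)"
      "bridge (Suc n) k = mat_mul (S n) ?D (mat_mul (S n) (bridge n k) ?U)"
      using \<open>k < n\<close> by simp_all
    have "mat_mul (S n) ?D (mat_mul (S n) (T n) (mat_mul (S n) (bridge n (Suc k)) ?U)) r s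
        = mat_mul (S n) ?D (mat_mul (S n) (mat_mul (S n) (T n) (bridge n (Suc k))) ?U) r s"
      by (simp add: mat_mul_assoc)
    also have "\<dots> = mat_mul (S n) ?D (mat_mul (S n) (\<lambda>r s. (1 - c k / c n) * bridge n (Suc k) r s
          + c k / c n * bridge n k r s) ?U) r s"
      using Suc.IH[OF \<open>k < n\<close>] by (intro mat_mul_cong) simp_all
    also have "\<dots> = (1 - c k / c n) * bridge (Suc n) (Suc k) r s + c k / c n * bridge (Suc n) k r s"
      unfolding b mat_mul_add_left[abs_def] mat_mul_add_right by simp
    finally have *: "mat_mul (S n) ?D (mat_mul (S n) (T n) (mat_mul (S n) (bridge n (Suc k)) ?U)) r s
      = (1 - c k / c n) * bridge (Suc n) (Suc k) r s + c k / c n * bridge (Suc n) k r s" .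
    have "mat_mul (S (Suc n)) (T (Suc n)) (bridge (Suc n) (Suc k)) r s
        = ?b * ((1 - c k / c n) * bridge (Suc n) (Suc k) r s + c k / c n * bridge (Suc n) k r s)
        + (1 - ?b) * bridge (Suc n) (Suc k) r s"
      using trans_down[OF Suc.prems(2), of "mat_mul (S n) (bridge n (Suc k)) ?U" s]
      unfolding b[symmetric] * .
    also have "\<dots> = (1 - ?b * (c k / c n)) * bridge (Suc n) (Suc k) r s
        + ?b * (c k / c n) * bridge (Suc n) k r s"
      by (simp only: algebra_simps)
    also have "?b * (c k / c n) = c k / c (Suc n)"
      using c_pos[of n] by (simp add: \<beta>_Suc)
    finally show ?thesis .
  qed
qed

lemma Tpow_Suc_bridge:
  assumes "k < n" "s \<in> S n"
  shows "mat_mul (S n) (Tpow n (Suc m)) (bridge n (Suc k)) r s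
    = (1 - c k / c n) * mat_mul (S n) (Tpow n m) (bridge n (Suc k)) r s
      + c k / c n * mat_mul (S n) (Tpow n m) (bridge n k) r s"
proof -
  have "mat_mul (S n) (Tpow n (Suc m)) (bridge n (Suc k)) r s
      = mat_mul (S n) (Tpow n m) (mat_mul (S n) (T n) (bridge n (Suc k))) r s"
    by (simp add: mat_mul_assoc)
  also have "\<dots> = mat_mul (S n) (Tpow n m) (\<lambda>r s. (1 - c k / c n) * bridge n (Suc k) r s
      + c k / c n * bridge n k r s) r s"
    using trans_bridge[OF assms(1) _ assms(2)] by (intro mat_mul_cong) simp_all
  finally show ?thesis
    unfolding mat_mul_add_right .
qed

section \<open>Comparison with the death chain\<close>

lemma Tpow_bridge_0:
  assumes "r \<in> S n" "s \<in> S n"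
  shows "mat_mul (S n) (Tpow n m) (bridge n 0) r s = M n s"
  using bridge_0 stochastic_matrix_sum[OF stochastic_Tpow assms(1)] assms
  by (simp add: mat_mul_def flip: sum_distrib_right)

text \<open>Both sides obey the same recursion in \<open>m\<close> and \<open>k\<close>, whose
  weights are nonnegative because \<open>c\<close> increases, so the inequality propagates from time
  0. There the left side vanishes for \<open>k > 0\<close>, and for \<open>k = 0\<close> both sides
  are \<open>M n s\<close>.\<close>

lemma Tpow_bridge_ge:
  assumes "k \<le> n" "r \<in> S n" "s \<in> S n"
  shows "(1 - survival c (c n) k m) * M n s \<le> mat_mul (S n) (Tpow n m) (bridge n k) r s"
  using assms
proof (induction m arbitrary: k)
  case 0
  then show ?case
    by (cases "k = 0")
      (simp_all add: survival_level_0 survival_time_0 c_inj mat_mul_id_left finite_S bridge_0 bridge_nonneg)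
next
  case (Suc m)
  show ?case
  proof (cases k)
    case 0
    then show ?thesis
      using Tpow_bridge_0[of r n s "Suc m"] Suc.prems by (simp add: survival_level_0)
  next
    case (Suc k')
    then have "k' < n"
      using Suc.prems by simp
    then have le: "c k' / c n \<le> 1"
      using c_strict_mono c_pos[of n] by (simp add: strict_mono_less less_imp_le)
    have "(1 - survival c (c n) k (Suc m)) * M n s
        = (1 - c k' / c n) * ((1 - survival c (c n) k m) * M n s)
          + c k' / c n * ((1 - survival c (c n) k' m) * M n s)"
      using c_pos[of n] unfolding \<open>k = Suc k'\<close>
      by (subst survival_Suc) (simp_all add: c_inj algebra_simps)
    also have "\<dots> \<le> (1 - c k' / c n) * mat_mul (S n) (Tpow n m) (bridge n k) r s
          + c k' / c n * mat_mul (S n) (Tpow n m) (bridge n k') r s"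
      using Suc.IH Suc.prems \<open>k' < n\<close> le c_pos[of k'] c_pos[of n]
      by (intro add_mono mult_left_mono) auto
    also have "\<dots> = mat_mul (S n) (Tpow n (Suc m)) (bridge n k) r s"
      using Tpow_Suc_bridge[OF \<open>k' < n\<close> Suc.prems(3)] by (simp add: \<open>k = Suc k'\<close>)
    finally show ?thesis .
  qed
qed

lemma Tpow_ge:
  assumes "r \<in> S n" "s \<in> S n"
  shows "(1 - survival c (c n) n m) * M n s \<le> Tpow n m r s"
  using Tpow_bridge_ge[of n n r s m] assms by (simp add: bridge_self mat_mul_id_right finite_S)

text \<open>\<open>bridge n k\<close> is a polynomial in \<open>T n\<close> of degree \<open>n - k\<close>.\<close>

lemma Tpow_bridge_eq_0:
  assumes zero: "\<And>m. m < n \<Longrightarrow> Tpow n m r s = 0" and "s \<in> S n" "k \<le> n" "j < k"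
  shows "mat_mul (S n) (Tpow n j) (bridge n k) r s = 0"
  using assms(3,4)
proof (induction k arbitrary: j rule: inc_induct)
  case base
  then show ?case
    using zero assms(2) by (simp add: bridge_self mat_mul_id_right finite_S)
next
  case (step k)
  \<comment> \<open>As \<open>Suc j < Suc k\<close>, the induction hypothesis kills the powers
    \<open>j\<close> and \<open>Suc j\<close> against \<open>bridge n (Suc k)\<close>, and the
    recursion leaves only this term.\<close>
  have "c k / c n * mat_mul (S n) (Tpow n j) (bridge n k) r s = 0"
    using Tpow_Suc_bridge[of k n s j r] step.IH[of j] step.IH[of "Suc j"] step.hyps step.prems assms(2)
    by simp
  then show ?case
    using c_pos[of k] c_pos[of n] by simp
qed

text \<open>The recursion behind \<open>Tpow_bridge_ge\<close>, now with exact initial values: at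
  time 0 every \<open>bridge n k\<close> with \<open>0 < k\<close> vanishes at \<open>(r, s)\<close>
  by \<open>Tpow_bridge_eq_0\<close>.\<close>

lemma Tpow_eq:
  assumes zero: "\<And>m. m < n \<Longrightarrow> Tpow n m r s = 0" and rs: "r \<in> S n" "s \<in> S n"
  shows "Tpow n m r s = (1 - survival c (c n) n m) * M n s"
proof -
  have "mat_mul (S n) (Tpow n m) (bridge n k) r s = (1 - survival c (c n) k m) * M n s"
    if "k \<le> n" for k
    using that
  proof (induction m arbitrary: k)
    case 0
    then show ?case
      using Tpow_bridge_eq_0[OF zero rs(2) 0, of 0] rs
      by (cases "k = 0")
        (simp_all add: survival_level_0 survival_time_0 c_inj mat_mul_id_left finite_S bridge_0)
  next
    case (Suc m)
    show ?case
    proof (cases k)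
      case 0
      then show ?thesis
        using Tpow_bridge_0[OF rs, of "Suc m"] by (simp add: survival_level_0)
    next
      case (Suc k')
      then have "k' < n"
        using Suc.prems by simp
      then show ?thesis
        using Tpow_Suc_bridge[OF \<open>k' < n\<close> rs(2), of m r] Suc.IH[of k] Suc.IH[of k'] Suc.prems c_pos[of n]
        unfolding \<open>k = Suc k'\<close>
        by (subst survival_Suc) (simp_all add: c_inj algebra_simps)
    qed
  qed
  from this[of n] show ?thesis
    using rs by (simp add: bridge_self mat_mul_id_right finite_S)
qed

text \<open>\<open>Tpow_ge\<close> bounds every member of the set by \<open>survival\<close>, and
  \<open>Tpow_eq\<close> shows that the pair \<open>(r, s)\<close> attains this bound.\<close>

lemma sep_dist_eq_survival:
  assumes zero: "\<And>m. m < n \<Longrightarrow> Tpow n m r s = 0" and rs: "r \<in> S n" "s \<in> S n" and "M n s > 0"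
  shows "sep_dist S up down e n m = survival c (c n) n m"
  unfolding sep_dist_def
proof (rule Max_eqI)
  let ?X = "{1 - Tpow n m r s / M n s |r s. r \<in> S n \<and> s \<in> S n \<and> M n s \<noteq> 0}"
  have "?X \<subseteq> (\<lambda>(r, s). 1 - Tpow n m r s / M n s) ` (S n \<times> S n)"
    by auto
  then show "finite ?X"
    by (rule finite_subset) (simp add: finite_S)
  show "y \<le> survival c (c n) n m" if y: "y \<in> ?X" for y
  proof -
    obtain r s where *: "y = 1 - Tpow n m r s / M n s" "r \<in> S n" "s \<in> S n" "M n s \<noteq> 0"
      using y by auto
    then have "M n s > 0"
      using M_nonneg[of s n] by simp
    then have "1 - survival c (c n) n m \<le> Tpow n m r s / M n s"
      using Tpow_ge[of r n s m] * by (simp add: pos_le_divide_eq)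
    then show ?thesis
      using * by simp
  qed
  have "survival c (c n) n m = 1 - Tpow n m r s / M n s"
    using Tpow_eq[OF zero rs, of m] \<open>M n s > 0\<close> by simp
  then show "survival c (c n) n m \<in> ?X"
    using rs \<open>M n s > 0\<close> by (intro CollectI exI[of _ r] exI[of _ s]) simp
qed

end

subsection \<open>The continuous-time chain\<close>

text \<open>Expands \<open>exp (x (K - I)) = exp (- x) exp (x K)\<close> along the iterates \<open>\<tau> m = K^m f\<close>.\<close>

lemma op_exp_poisson:
  fixes K :: "('a \<Rightarrow> real) \<Rightarrow> 'a \<Rightarrow> real"
  assumes start: "\<And>r. r \<in> A \<Longrightarrow> \<tau> 0 r = f r"
    and step: "\<And>g w k r. r \<in> A \<Longrightarrow> (\<And>u. u \<in> A \<Longrightarrow> g u = (\<Sum>j\<le>k. w j * \<tau> j u))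
      \<Longrightarrow> K g r = (\<Sum>j\<le>k. w j * \<tau> (Suc j) r)"
    and bounded: "\<And>m. \<bar>\<tau> m r\<bar> \<le> B" and "r \<in> A"
  shows "op_exp (\<lambda>g r. x * (K g r - g r)) f r = exp (- x) * (\<Sum>m. x ^ m / fact m * \<tau> m r)"
proof -
  let ?L = "\<lambda>g r. x * (K g r - g r)"
  let ?b = "\<lambda>k j. real (k choose j) * x ^ j * (- x) ^ (k - j)"
  \<comment> \<open>Binomial expansion of \<open>(x K - x I)^k\<close>. The hypothesis
    \<open>step\<close> stands in for linearity of \<open>K\<close> and refers only to values on
    \<open>A\<close>.\<close>
  have pow: "(?L ^^ k) f r = (\<Sum>j\<le>k. ?b k j * \<tau> j r)" if "r \<in> A" for k r
    using that
  proof (induction k arbitrary: r)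
    case 0
    then show ?case
      using start by simp
  next
    case (Suc k)
    have "(?L ^^ Suc k) f r = x * ((\<Sum>j\<le>k. ?b k j * \<tau> (Suc j) r) - (\<Sum>j\<le>k. ?b k j * \<tau> j r))"
      using step[OF Suc.prems, where g = "(?L ^^ k) f" and k = k and w = "?b k"] Suc.IH Suc.prems by simp
    also have "\<dots> = (\<Sum>j\<le>k. x * ?b k j * \<tau> (Suc j) r) + (\<Sum>j\<le>k. - x * ?b k j * \<tau> j r)"
      by (simp add: sum_distrib_left right_diff_distrib sum_negf mult_ac)
    also have "(\<Sum>j\<le>k. - x * ?b k j * \<tau> j r)
        = (\<Sum>j\<le>k. real (k choose j) * x ^ j * (- x) ^ (Suc k - j) * \<tau> j r)"
      by (intro sum.cong) (simp_all add: Suc_diff_le)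
    \<comment> \<open>The added summand vanishes because \<open>k choose Suc k\<close> is 0. After
      an index shift the two sums combine by Pascal's rule.\<close>
    also have "\<dots> = (\<Sum>j\<le>Suc k. real (k choose j) * x ^ j * (- x) ^ (Suc k - j) * \<tau> j r)"
      by simp
    also have "\<dots> = (- x) ^ Suc k * \<tau> 0 r
        + (\<Sum>j\<le>k. real (k choose Suc j) * x ^ Suc j * (- x) ^ (k - j) * \<tau> (Suc j) r)"
      by (subst sum.atMost_Suc_shift) simp
    also have "(\<Sum>j\<le>k. x * ?b k j * \<tau> (Suc j) r) + \<dots> = (\<Sum>j\<le>Suc k. ?b (Suc k) j * \<tau> j r)"
      by (subst sum.atMost_Suc_shift) (simp add: sum.distrib algebra_simps)
    finally show ?case .
  qed
  let ?u = "\<lambda>j. x ^ j / fact j * \<tau> j r" and ?v = "\<lambda>j. (- x) ^ j / fact j"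
  have norm_exp: "summable (\<lambda>j. norm (y ^ j / fact j))" for y :: real
    using summable_norm_exp[of y] by (simp add: field_simps)
  have "summable (\<lambda>j. norm (?u j))"
  proof (rule summable_comparison_test'[OF summable_mult[OF norm_exp[of x], of B]])
    fix j
    show "norm (norm (?u j)) \<le> B * norm (x ^ j / fact j)"
      using mult_right_mono[OF bounded[of j], of "norm (x ^ j / fact j)"]
      by (simp add: abs_mult mult.commute)
  qed
  then have "(\<Sum>j. ?u j) * (\<Sum>j. ?v j) = (\<Sum>k. \<Sum>j\<le>k. ?u j * ?v (k - j))"
    by (rule Cauchy_product) (rule norm_exp)
  also have "(\<Sum>j. ?v j) = exp (- x)"
    by (simp add: exp_def field_simps)
  also have "(\<lambda>k. \<Sum>j\<le>k. ?u j * ?v (k - j)) = (\<lambda>k. (?L ^^ k) f r / fact k)"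
    unfolding pow[OF \<open>r \<in> A\<close>] sum_divide_distrib
    by (intro ext sum.cong) (simp_all add: binomial_fact)
  finally show ?thesis
    by (simp add: op_exp_def mult.commute)
qed

lemma poisson_sums: "(\<lambda>m. x ^ m / fact m * q ^ m) sums exp (x * q)" for x q :: real
  using exp_converges[of "x * q"] by (simp add: field_simps)

text \<open>The probability that a sum of independent exponential variables with rates
  \<open>c 0, \<dots>, c (k - 1)\<close> exceeds \<open>t\<close>.\<close>

definition survival_cont :: "(nat \<Rightarrow> real) \<Rightarrow> nat \<Rightarrow> real \<Rightarrow> real" where
  "survival_cont c k t = (\<Sum>i<k. exp (- t * c i) * (\<Prod>j<k. limit_factor c i j))"

text \<open>Poissonization: a clock of rate \<open>N\<close> turns geometric waiting times with
  success probability \<open>c i / N\<close> into exponential ones with rate \<open>c i\<close>. The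
  affine form serves two uses: \<open>b = 0\<close> for the upper bound on the separation distance,
  \<open>b = \<epsilon>\<close> for perturbed indicators.\<close>

lemma poisson_survival:
  assumes "N \<noteq> 0"
  shows "(\<lambda>m. (t * N) ^ m / fact m * ((1 - survival c N k m) * a + b))
    sums (exp (t * N) * ((1 - survival_cont c k t) * a + b))"
proof -
  let ?p = "\<lambda>i. \<Prod>j<k. limit_factor c i j"
  have "(\<lambda>m. \<Sum>i<k. (t * N) ^ m / fact m * (1 - c i / N) ^ m * ?p i)
      sums (\<Sum>i<k. exp (t * N * (1 - c i / N)) * ?p i)"
    by (intro sums_sum sums_mult2 poisson_sums)
  moreover have "exp (t * N * (1 - c i / N)) = exp (t * N) * exp (- t * c i)" for i
    using assms by (simp add: algebra_simps flip: exp_add)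
  ultimately have "(\<lambda>m. (t * N) ^ m / fact m * survival c N k m)
      sums (exp (t * N) * survival_cont c k t)"
    by (simp add: survival_def survival_cont_def sum_distrib_left mult_ac)
  moreover have "(\<lambda>m. (t * N) ^ m / fact m) sums exp (t * N)"
    using poisson_sums[of "t * N" 1] by simp
  ultimately have "(\<lambda>m. (t * N) ^ m / fact m * (a + b) - (t * N) ^ m / fact m * survival c N k m * a)
      sums (exp (t * N) * (a + b) - exp (t * N) * survival_cont c k t * a)"
    by (intro sums_diff sums_mult2)
  then show ?thesis
    by (simp add: algebra_simps)
qed

context up_down_chain
begin

section \<open>The semigroup as a Poisson mixture of transition powers\<close>

lemma Tpow_fun_bound:
  assumes "r \<in> S n"
  shows "\<bar>\<Sum>s\<in>S n. Tpow n m r s * f s\<bar> \<le> (\<Sum>s\<in>S n. \<bar>f s\<bar>)"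
proof -
  have "Tpow n m r s \<le> 1" if "s \<in> S n" for s
    using member_le_sum[OF that, of "Tpow n m r"] stochastic_matrix_sum[OF stochastic_Tpow assms]
      stochastic_matrix_nonneg[OF stochastic_Tpow assms] finite_S by auto
  then have "\<bar>Tpow n m r s * f s\<bar> \<le> \<bar>f s\<bar>" if "s \<in> S n" for s
    using stochastic_matrix_nonneg[OF stochastic_Tpow assms that] that
    by (simp add: abs_mult mult_left_le_one_le)
  then show ?thesis
    by (intro order.trans[OF sum_abs] sum_mono)
qed

lemma op_exp_trans_op:
  assumes "r \<in> S n"
  shows "op_exp (\<lambda>g x. t * c n * (trans_op S up down n g x - g x)) f r
    = exp (- (t * c n)) * (\<Sum>m. (t * c n) ^ m / fact m * (\<Sum>s\<in>S n. Tpow n m r s * f s))"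
proof (rule op_exp_poisson[where A = "S n"])
  show "(\<Sum>s\<in>S n. Tpow n 0 r s * f s) = f r" if "r \<in> S n" for r
    using mat_mul_id_left[OF finite_S that, of "\<lambda>s _. f s"] by (simp add: mat_mul_def)
  show "trans_op S up down n g r = (\<Sum>j\<le>k. w j * (\<Sum>s\<in>S n. Tpow n (Suc j) r s * f s))"
    if "r \<in> S n" and g: "\<And>u. u \<in> S n \<Longrightarrow> g u = (\<Sum>j\<le>k. w j * (\<Sum>s\<in>S n. Tpow n j u s * f s))"
    for g w k r
  proof -
    have "(\<Sum>u\<in>S n. T n r u * (\<Sum>s\<in>S n. Tpow n j u s * f s)) = (\<Sum>s\<in>S n. Tpow n (Suc j) r s * f s)"
      for j
    proof -
      have "(\<Sum>u\<in>S n. T n r u * (\<Sum>s\<in>S n. Tpow n j u s * f s))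
          = (\<Sum>s\<in>S n. mat_mul (S n) (T n) (Tpow n j) r s * f s)"
        unfolding mat_mul_def sum_distrib_left sum_distrib_right
        by (subst sum.swap) (simp add: mult.assoc)
      then show ?thesis
        using mat_pow_commute[OF finite_S that(1)] by simp
    qed
    moreover have "trans_op S up down n g r
        = (\<Sum>j\<le>k. w j * (\<Sum>u\<in>S n. T n r u * (\<Sum>s\<in>S n. Tpow n j u s * f s)))"
    proof -
      have "trans_op S up down n g r
          = (\<Sum>u\<in>S n. \<Sum>j\<le>k. w j * (T n r u * (\<Sum>s\<in>S n. Tpow n j u s * f s)))"
        by (simp add: trans_op_def g sum_distrib_left mult.left_commute)
      then show ?thesis
        by (subst (asm) sum.swap) (simp add: sum_distrib_left)
    qed
    ultimately show ?thesis
      by simp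
  qed
qed (use Tpow_fun_bound assms in auto)

lemma poisson_Tpow_summable:
  assumes "r \<in> S n"
  shows "summable (\<lambda>m. x ^ m / fact m * (\<Sum>s\<in>S n. Tpow n m r s * f s))"
proof (rule summable_comparison_test')
  show "summable (\<lambda>m. \<bar>x\<bar> ^ m / fact m * (\<Sum>s\<in>S n. \<bar>f s\<bar>))"
    using sums_summable[OF poisson_sums[of "\<bar>x\<bar>" 1]] by (intro summable_mult2) simp
  show "norm (x ^ m / fact m * (\<Sum>s\<in>S n. Tpow n m r s * f s))
      \<le> \<bar>x\<bar> ^ m / fact m * (\<Sum>s\<in>S n. \<bar>f s\<bar>)" for m
    using mult_left_mono[OF Tpow_fun_bound[OF assms, of m f], of "\<bar>x\<bar> ^ m / fact m"]
    by (simp add: abs_mult power_abs)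
qed

text \<open>The upper bound is \<open>Tpow_ge\<close> integrated against \<open>f\<close> and
  averaged with Poisson weights. The indicator of \<open>s\<close> would give equality but is in
  general not strictly positive, so it is approximated by positive functions.\<close>

lemma sep_dist_cont_eq_survival_cont:
  assumes zero: "\<And>m. m < n \<Longrightarrow> Tpow n m r s = 0" and rs: "r \<in> S n" "s \<in> S n" and "M n s > 0"
    and "0 < t"
  shows "sep_dist_cont S up down e c n t = survival_cont c n t"
  unfolding sep_dist_cont_def
proof (rule cSup_eq)
  let ?E = "op_exp (\<lambda>g x. t * c n * (trans_op S up down n g x - g x))"
  let ?X = "{1 - ?E f r / (\<Sum>s\<in>S n. f s * M n s) |r f. r \<in> S n \<and> (\<forall>s\<in>S n. 0 < f s)}"
  show "y \<le> survival_cont c n t" if "y \<in> ?X" for y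
  proof -
    obtain r f where y: "y = 1 - ?E f r / (\<Sum>s\<in>S n. f s * M n s)"
      and r: "r \<in> S n" and f: "\<And>s. s \<in> S n \<Longrightarrow> 0 < f s"
      using \<open>y \<in> ?X\<close> by auto
    let ?I = "\<Sum>s\<in>S n. f s * M n s"
    have "0 < ?I"
      using f M_nonneg \<open>M n s > 0\<close> rs(2)
      by (intro sum_pos2[of _ s] finite_S mult_nonneg_nonneg) (auto intro: less_imp_le)
    have le: "(1 - survival c (c n) n m) * ?I + 0 \<le> (\<Sum>s\<in>S n. Tpow n m r s * f s)" for m
    proof -
      have "(\<Sum>s\<in>S n. (1 - survival c (c n) n m) * M n s * f s) \<le> (\<Sum>s\<in>S n. Tpow n m r s * f s)"
        using f Tpow_ge[OF r] by (intro sum_mono mult_right_mono) (auto simp: less_imp_le)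
      then show ?thesis
        by (simp add: sum_distrib_left mult_ac)
    qed
    have "exp (t * c n) * ((1 - survival_cont c n t) * ?I + 0)
        \<le> (\<Sum>m. (t * c n) ^ m / fact m * (\<Sum>s\<in>S n. Tpow n m r s * f s))"
      using c_pos[of n] \<open>0 < t\<close>
      by (intro sums_le[OF _ poisson_survival summable_sums] poisson_Tpow_summable r mult_left_mono le)
        auto
    then have "exp (- (t * c n)) * (exp (t * c n) * ((1 - survival_cont c n t) * ?I + 0)) \<le> ?E f r"
      by (simp add: op_exp_trans_op r)
    then have "(1 - survival_cont c n t) * ?I \<le> ?E f r"
      by (simp add: mult.assoc[symmetric] flip: exp_add)
    then have "1 - survival_cont c n t \<le> ?E f r / ?I"
      using \<open>0 < ?I\<close> by (simp add: pos_le_divide_eq)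
    then show ?thesis
      by (simp add: y)
  qed
  fix y
  assume y: "\<And>x. x \<in> ?X \<Longrightarrow> x \<le> y"
  \<comment> \<open>This is the value obtained from the indicator of \<open>s\<close> plus the
    constant \<open>\<epsilon>\<close>; it tends to \<open>survival_cont c n t\<close> as
    \<open>\<epsilon>\<close> decreases to 0.\<close>
  let ?h = "\<lambda>\<epsilon>. 1 - ((1 - survival_cont c n t) * M n s + \<epsilon>) / (M n s + \<epsilon>)"
  have "?h \<epsilon> \<le> y" if "0 < \<epsilon>" for \<epsilon>
  proof -
    let ?f = "\<lambda>u. id_mat u s + \<epsilon>"
    have int: "(\<Sum>u\<in>S n. w u * ?f u) = w s + \<epsilon>" if "(\<Sum>u\<in>S n. w u) = 1" for w
      using mat_mul_id_right[OF finite_S rs(2), of "\<lambda>_. w"] that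
      by (simp add: mat_mul_def distrib_left sum.distrib flip: sum_distrib_right)
    have "(\<Sum>u\<in>S n. Tpow n m r u * ?f u) = (1 - survival c (c n) n m) * M n s + \<epsilon>" for m
      using int[OF stochastic_matrix_sum[OF stochastic_Tpow rs(1)]] Tpow_eq[OF zero rs] by simp
    then have "?E ?f r = exp (- (t * c n))
        * (exp (t * c n) * ((1 - survival_cont c n t) * M n s + \<epsilon>))"
      using sums_unique[OF poisson_survival[of "c n" t c n "M n s" \<epsilon>]] c_pos[of n]
      by (simp add: op_exp_trans_op rs)
    then have "?E ?f r = (1 - survival_cont c n t) * M n s + \<epsilon>"
      by (simp add: mult.assoc[symmetric] flip: exp_add)
    moreover have "(\<Sum>u\<in>S n. ?f u * M n u) = M n s + \<epsilon>"
      using int[OF M_sum] by (simp add: mult.commute)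
    ultimately have "?h \<epsilon> = 1 - ?E ?f r / (\<Sum>u\<in>S n. ?f u * M n u)"
      by simp
    then show ?thesis
      using \<open>0 < \<epsilon>\<close> rs(1)
      by (intro y CollectI exI[of _ r] exI[of _ ?f]) (auto simp: id_mat_def)
  qed
  then have "eventually (\<lambda>\<epsilon>. ?h \<epsilon> \<le> y) (at_right 0)"
    by (auto simp: eventually_at_right_field intro: exI[of _ 1])
  moreover have "(?h \<longlongrightarrow> 1 - ((1 - survival_cont c n t) * M n s + 0) / (M n s + 0)) (at_right 0)"
    using \<open>M n s > 0\<close> by (intro tendsto_intros) auto
  ultimately have "1 - ((1 - survival_cont c n t) * M n s + 0) / (M n s + 0) \<le> y"
    by (intro tendsto_upperbound) auto
  then show "survival_cont c n t \<le> y"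
    using \<open>M n s > 0\<close> by simp
qed

end

subsection \<open>The limit of the separation distances\<close>

text \<open>The finitely many large summands \<open>1 / a k\<close> only contribute a polynomial in \<open>x\<close>.\<close>

lemma prod_one_plus_le_exp:
  fixes a :: "nat \<Rightarrow> real"
  assumes pos: "\<And>k. 0 < a k" and "summable (\<lambda>k. 1 / a k)" and "0 < \<delta>"
  shows "\<exists>C\<ge>1. \<forall>n. \<forall>x\<ge>0. (\<Prod>k<n. 1 + x / a k) \<le> C * exp (\<delta> * x)"
proof -
  \<comment> \<open>The exponent is split evenly: the factors from \<open>K\<close> on use one half
    through \<open>1 + y \<le> exp y\<close>, the first \<open>K\<close> factors use the
    other.\<close>
  obtain K where "\<bar>\<Sum>k. 1 / a (k + K)\<bar> < \<delta> / 2"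
    using suminf_exist_split[OF half_gt_zero[OF \<open>0 < \<delta>\<close>] assms(2)] by auto
  then have tail: "(\<Sum>k<n. 1 / a (k + K)) \<le> \<delta> / 2" for n
    using sum_le_suminf[of "\<lambda>k. 1 / a (k + K)" "{..<n}"] summable_ignore_initial_segment[OF assms(2)]
      pos by (force simp: less_imp_le)
  \<comment> \<open>Each of the first \<open>K\<close> factors costs
    \<open>exp (\<eta> * x)\<close>, so \<open>K * \<eta> \<le> \<delta> / 2\<close> is wanted; the
    \<open>+ 1\<close> keeps the denominator positive when \<open>K = 0\<close>.\<close>
  define \<eta> where "\<eta> = \<delta> / (2 * (real K + 1))"
  have "\<eta> > 0"
    using \<open>0 < \<delta>\<close> by (simp add: \<eta>_def)
  define C where "C = (\<Prod>k<K. 1 + 1 / (a k * \<eta>))"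
  have "C \<ge> 1"
    unfolding C_def using pos \<open>\<eta> > 0\<close> by (intro prod_ge_1) (auto simp: less_imp_le)
  have "(\<Prod>k<n. 1 + x / a k) \<le> C * exp (\<delta> * x)" if "x \<ge> 0" for n x
  proof -
    have nonneg: "0 \<le> x / a k" for k
      using pos[of k] \<open>x \<ge> 0\<close> by simp
    have "(\<Prod>k<n. 1 + x / a k) \<le> (\<Prod>k<n + K. 1 + x / a k)"
      using nonneg by (intro prod_mono2) (auto intro: add_nonneg_nonneg)
    also have "\<dots> = (\<Prod>k<K. 1 + x / a k) * (\<Prod>k<n. 1 + x / a (k + K))"
      by (induction n) (simp_all add: add.commute)
    also have "\<dots> \<le> (C * exp (\<delta> / 2 * x)) * exp (\<delta> / 2 * x)"
    proof (intro mult_mono)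
      have "1 + x / a k \<le> (1 + 1 / (a k * \<eta>)) * exp (\<eta> * x)" for k
      proof -
        have "1 + x / a k \<le> (1 + 1 / (a k * \<eta>)) * (1 + \<eta> * x)"
        proof -
          have "(1 + 1 / (a k * \<eta>)) * (1 + \<eta> * x) = (1 + x / a k) + (\<eta> * x + 1 / (a k * \<eta>))"
            using pos[of k] \<open>\<eta> > 0\<close> by (simp add: field_simps)
          then show ?thesis
            using pos[of k] \<open>\<eta> > 0\<close> \<open>x \<ge> 0\<close> by simp
        qed
        also have "\<dots> \<le> (1 + 1 / (a k * \<eta>)) * exp (\<eta> * x)"
          using pos[of k] \<open>\<eta> > 0\<close> exp_ge_add_one_self by (intro mult_left_mono) auto
        finally show ?thesis .
      qed
      then have "(\<Prod>k<K. 1 + x / a k) \<le> (\<Prod>k<K. (1 + 1 / (a k * \<eta>)) * exp (\<eta> * x))"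
        using nonneg by (intro prod_mono) (auto intro: add_nonneg_nonneg)
      also have "\<dots> = C * exp (real K * \<eta> * x)"
        by (simp add: prod.distrib C_def mult.assoc flip: exp_of_nat_mult)
      also have "\<dots> \<le> C * exp (\<delta> / 2 * x)"
      proof -
        have "real K * \<eta> \<le> \<delta> / 2"
          using \<open>0 < \<delta>\<close> by (simp add: \<eta>_def field_simps)
        then have "real K * \<eta> * x \<le> \<delta> / 2 * x"
          using \<open>x \<ge> 0\<close> by (rule mult_right_mono)
        then show ?thesis
          using \<open>C \<ge> 1\<close> by (intro mult_left_mono) simp_all
      qed
      finally show "(\<Prod>k<K. 1 + x / a k) \<le> C * exp (\<delta> / 2 * x)" .
      have "(\<Prod>k<n. 1 + x / a (k + K)) \<le> (\<Prod>k<n. exp (x / a (k + K)))"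
        using nonneg exp_ge_add_one_self by (intro prod_mono) (auto intro: add_nonneg_nonneg)
      also have "\<dots> = exp (x * (\<Sum>k<n. 1 / a (k + K)))"
        by (simp add: exp_sum sum_distrib_left)
      also have "\<dots> \<le> exp (\<delta> / 2 * x)"
        using mult_left_mono[OF tail[of n] \<open>x \<ge> 0\<close>] by (simp add: mult.commute)
      finally show "(\<Prod>k<n. 1 + x / a (k + K)) \<le> exp (\<delta> / 2 * x)" .
    qed (use \<open>C \<ge> 1\<close> nonneg in \<open>auto intro!: prod_nonneg add_nonneg_nonneg\<close>)
    also have "\<dots> = C * exp (\<delta> * x)"
      by (simp flip: exp_add)
    finally show ?thesis .
  qed
  then show ?thesis
    using \<open>C \<ge> 1\<close> by blast
qed

section \<open>Uniform bounds on products of limit factors for convex rates\<close>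

locale convex_rates =
  fixes c :: "nat \<Rightarrow> real"
  assumes c_pos: "0 < c n"
    and c_strict_mono: "strict_mono c"
    and c_convex: "incseq (\<lambda>n. c (Suc n) - c n)"
    and c_summable: "summable (\<lambda>n. 1 / c n)"
begin

abbreviation gap :: "nat \<Rightarrow> real" where
  "gap k \<equiv> c (Suc k) - c 0"

lemma gap_pos: "0 < gap k"
  using c_strict_mono by (simp add: strict_mono_less)

text \<open>\<open>gap k\<close> is comparable to \<open>c (Suc k)\<close>: the ratio
  \<open>1 - c 0 / c (Suc k)\<close> is at least its value \<open>gap 0 / c 1\<close> at
  \<open>k = 0\<close>.\<close>

lemma gap_summable: "summable (\<lambda>k. 1 / gap k)"
proof (rule summable_comparison_test')
  show "summable (\<lambda>k. c 1 / gap 0 * (1 / c (Suc k)))"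
    using c_summable by (intro summable_mult) (simp add: summable_Suc_iff[of "\<lambda>n. 1 / c n"])
  fix k
  have "c 1 \<le> c (Suc k)"
    using c_strict_mono by (simp add: strict_mono_less_eq)
  then have "c 0 * c 1 \<le> c 0 * c (Suc k)"
    using c_pos[of 0] by simp
  then have "gap 0 * c (Suc k) \<le> c 1 * gap k"
    by (simp add: algebra_simps)
  then have "1 / gap k \<le> c 1 / gap 0 * (1 / c (Suc k))"
    using gap_pos[of k] gap_pos[of 0] c_pos[of "Suc k"] by (simp add: divide_simps mult_ac)
  then show "norm (1 / gap k) \<le> c 1 / gap 0 * (1 / c (Suc k))"
    using gap_pos[of k] by simp
qed

text \<open>By convexity a block of increments starting at \<open>i\<close> dominates the block of
  equal length starting at 0. This makes the later bounds depend on \<open>i\<close> only through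
  \<open>c i\<close>.\<close>

lemma diff_ge_gap: "c (Suc k) - c 0 \<le> c (i + Suc k) - c i"
proof -
  have "c m - c 0 \<le> c (i + m) - c i" for m
  proof (induction m)
    case (Suc m)
    then show ?case
      using incseqD[OF c_convex, of m "i + m"] by simp
  qed simp
  then show ?thesis .
qed

text \<open>For \<open>j > i\<close> the factor equals \<open>1 + c i / (c j - c i)\<close>; for
  \<open>j < i\<close> its absolute value is
  \<open>c j / (c i - c j) \<le> c i / (c i - c j)\<close>. Convexity bounds either denominator
  below by the gap at index \<open>\<bar>i - j\<bar> - 1\<close>.\<close>

lemma abs_limit_factor_le:
  "i \<noteq> j \<Longrightarrow> \<bar>limit_factor c i j\<bar> \<le> 1 + c i / gap (if j < i then i - Suc j else j - Suc i)"
proof -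
  assume "i \<noteq> j"
  then consider "j < i" | "i < j"
    by linarith
  then show ?thesis
  proof cases
    case 1
    then have "gap (i - Suc j) \<le> c i - c j"
      using diff_ge_gap[of "i - Suc j" j] by (simp add: Suc_diff_Suc)
    then have "c i / (c i - c j) \<le> c i / gap (i - Suc j)" "0 < c i - c j"
      using gap_pos[of "i - Suc j"] c_pos[of i] by (auto intro!: divide_left_mono)
    moreover have "\<bar>limit_factor c i j\<bar> = c j / (c i - c j)"
      using 1 \<open>0 < c i - c j\<close> c_pos[of j] by (simp add: limit_factor_def abs_divide)
    moreover have "c j / (c i - c j) \<le> c i / (c i - c j)"
      using \<open>0 < c i - c j\<close> by (intro divide_right_mono) auto
    ultimately show ?thesis
      using 1 by simp
  next
    case 2
    then have "gap (j - Suc i) \<le> c j - c i"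
      using diff_ge_gap[of "j - Suc i" i] by (simp add: Suc_diff_Suc)
    then have "c i / (c j - c i) \<le> c i / gap (j - Suc i)" "0 < c j - c i"
      using gap_pos[of "j - Suc i"] c_pos[of i] by (auto intro!: divide_left_mono)
    moreover have "\<bar>limit_factor c i j\<bar> = 1 + c i / (c j - c i)"
      using 2 \<open>0 < c j - c i\<close> c_pos[of j] by (simp add: limit_factor_def abs_if field_simps)
    ultimately show ?thesis
      using 2 by simp
  qed
qed

text \<open>Indexed by their distance from \<open>i\<close>, the factors on each side of
  \<open>i\<close> are dominated by a product of terms \<open>1 + c i / gap k\<close>. Each side
  contributes \<open>C * exp (\<delta> / 2 * c i)\<close>.\<close>

lemma prod_limit_factor_le:
  assumes "0 < \<delta>"
  shows "\<exists>C>0. \<forall>i n. \<bar>\<Prod>j<n. limit_factor c i j\<bar> \<le> C * exp (\<delta> * c i)"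
proof -
  obtain C where C: "C \<ge> 1" "\<And>n x. x \<ge> 0 \<Longrightarrow> (\<Prod>k<n. 1 + x / gap k) \<le> C * exp (\<delta> / 2 * x)"
    using prod_one_plus_le_exp[OF gap_pos gap_summable half_gt_zero[OF assms]] by blast
  have "\<bar>\<Prod>j<n. limit_factor c i j\<bar> \<le> C\<^sup>2 * exp (\<delta> * c i)" for i n
  proof -
    let ?g = "\<lambda>k. 1 + c i / gap k"
    have ge1: "1 \<le> ?g k" for k
      using gap_pos[of k] c_pos[of i] by simp
    then have ge0: "0 \<le> ?g k" for k
      by (rule order.trans[rotated]) simp
    have "\<bar>\<Prod>j<n. limit_factor c i j\<bar>
        \<le> (\<Prod>j<n. (if j < i then ?g (i - Suc j) else 1) * (if i < j then ?g (j - Suc i) else 1))"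
      unfolding abs_prod
    proof (intro prod_mono conjI)
      fix j
      show "\<bar>limit_factor c i j\<bar>
          \<le> (if j < i then ?g (i - Suc j) else 1) * (if i < j then ?g (j - Suc i) else 1)"
        using abs_limit_factor_le[of i j] by (cases "i = j") (auto simp: limit_factor_def split: if_splits)
    qed simp
    also have "\<dots> = (\<Prod>j\<in>{..<n} \<inter> {j. j < i}. ?g (i - Suc j)) * (\<Prod>j\<in>{..<n} \<inter> {j. i < j}. ?g (j - Suc i))"
      by (simp add: prod.distrib prod.If_cases)
    also have "\<dots> \<le> (\<Prod>k<i. ?g k) * (\<Prod>k<n. ?g k)"
    proof (intro mult_mono)
      have "(\<Prod>j\<in>{..<n} \<inter> {j. j < i}. ?g (i - Suc j)) \<le> (\<Prod>j<i. ?g (i - Suc j))"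
        using ge1 ge0 by (intro prod_mono2) auto
      then show "(\<Prod>j\<in>{..<n} \<inter> {j. j < i}. ?g (i - Suc j)) \<le> (\<Prod>k<i. ?g k)"
        using prod.nat_diff_reindex[of ?g i] by simp
      have "(\<Prod>j\<in>{..<n} \<inter> {j. i < j}. ?g (j - Suc i))
          = (\<Prod>k\<in>(\<lambda>j. j - Suc i) ` ({..<n} \<inter> {j. i < j}). ?g k)"
        by (subst prod.reindex) (auto simp: inj_on_def)
      also have "\<dots> \<le> (\<Prod>k<n. ?g k)"
        using ge1 ge0 by (intro prod_mono2) auto
      finally show "(\<Prod>j\<in>{..<n} \<inter> {j. i < j}. ?g (j - Suc i)) \<le> (\<Prod>k<n. ?g k)" .
    qed (use ge0 in \<open>auto intro!: prod_nonneg\<close>)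
    also have "\<dots> \<le> (C * exp (\<delta> / 2 * c i)) * (C * exp (\<delta> / 2 * c i))"
      using C c_pos[of i] ge0 by (intro mult_mono C) (auto intro!: prod_nonneg)
    also have "\<dots> = C\<^sup>2 * exp (\<delta> * c i)"
      by (simp add: power2_eq_square mult_ac flip: exp_add)
    finally show ?thesis .
  qed
  moreover have "0 < C\<^sup>2"
    using \<open>C \<ge> 1\<close> by simp
  ultimately show ?thesis
    by blast
qed

text \<open>Beyond index \<open>i\<close> a factor differs from 1 by
  \<open>c i / (c j - c i)\<close>, which the summable \<open>c i / gap\<close> dominates; hence the
  product converges absolutely.\<close>

lemma convergent_prod_limit_factor: "convergent_prod (limit_factor c i)"
proof -
  have "summable (\<lambda>j. norm (limit_factor c i (j + Suc i) - 1))"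
  proof (rule summable_comparison_test')
    show "summable (\<lambda>j. c i * (1 / gap j))"
      by (rule summable_mult[OF gap_summable])
    fix j
    have d: "gap j \<le> c (j + Suc i) - c i" "0 < gap j"
      using diff_ge_gap[of j i] gap_pos[of j] by simp_all (simp add: add.commute)
    have "x / (x - y) - 1 = y / (x - y)" if "x - y \<noteq> 0" for x y :: real
      using that by (simp add: field_simps)
    then have "limit_factor c i (j + Suc i) - 1 = c i / (c (j + Suc i) - c i)"
      using d by (simp add: limit_factor_def)
    moreover have "c i / (c (j + Suc i) - c i) \<le> c i * (1 / gap j)"
      using d c_pos[of i] by (auto intro!: divide_left_mono)
    ultimately show "norm (norm (limit_factor c i (j + Suc i) - 1)) \<le> c i * (1 / gap j)"
      using d c_pos[of i] by simp
  qed
  then have "summable (\<lambda>j. norm (limit_factor c i j - 1))"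
    by (rule summable_iff_shift[THEN iffD1])
  then show ?thesis
    by (intro abs_convergent_prod_imp_convergent_prod summable_imp_abs_convergent_prod)
qed

lemma prod_limit_factor_tendsto:
  "(\<lambda>n. \<Prod>j<n. limit_factor c i j) \<longlonglongrightarrow> (\<Prod>j. limit_factor c i j)"
  using convergent_prod_LIMSEQ[OF convergent_prod_limit_factor, of i]
  by (subst (asm) lessThan_Suc_atMost[symmetric]) (rule filterlim_sequentially_Suc[THEN iffD1])

section \<open>Convergence to the limit series and decay of its tail\<close>

lemma summable_exp_rates:
  assumes "0 < t"
  shows "summable (\<lambda>i. exp (- t * c i))"
proof (rule summable_comparison_test'[OF summable_mult[OF c_summable, of "1 / t"]])
  fix i
  have "t * c i \<le> exp (t * c i)"
    using exp_ge_add_one_self[of "t * c i"] by linarith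
  then show "norm (exp (- t * c i)) \<le> 1 / t * (1 / c i)"
    using assms c_pos[of i] by (simp add: exp_minus divide_simps)
qed

text \<open>Tannery's theorem for general weights \<open>w\<close>, so that discrete and continuous
  time are treated at once. Half of the decay \<open>exp (- t * c i)\<close> absorbs the growth of
  the products, and the other half is summable.\<close>

lemma survival_tendsto:
  assumes "0 < t"
    and w: "\<And>i. (\<lambda>n. w n i) \<longlonglongrightarrow> exp (- t * c i)"
    and w_le: "\<And>n i. i < n \<Longrightarrow> \<bar>w n i\<bar> \<le> B * exp (- t * c i)"
  shows "summable (\<lambda>i. \<bar>limit_term c t i\<bar>)"
    and "(\<lambda>n. \<Sum>i<n. w n i * (\<Prod>j<n. limit_factor c i j)) \<longlonglongrightarrow> (\<Sum>i. limit_term c t i)"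
proof -
  obtain C where C: "C > 0" "\<And>i n. \<bar>\<Prod>j<n. limit_factor c i j\<bar> \<le> C * exp (t / 2 * c i)"
    using prod_limit_factor_le[OF half_gt_zero[OF assms(1)]] by blast
  \<comment> \<open>Extension by zero turns the sums of growing length into series over a fixed
    index set.\<close>
  define a where "a i n = (if i < n then w n i * (\<Prod>j<n. limit_factor c i j) else 0)" for i n
  have "0 \<le> B * exp (- t * c 0)"
    using w_le[of 0 1] by (rule order.trans[rotated]) simp_all
  then have "0 \<le> B"
    by (simp add: zero_le_mult_iff)
  have lim: "(\<lambda>n. a i n) \<longlonglongrightarrow> limit_term c t i" for i
    unfolding limit_term_def
  proof (rule Lim_transform_eventually[OF tendsto_mult[OF w prod_limit_factor_tendsto]])
    show "eventually (\<lambda>n. w n i * (\<Prod>j<n. limit_factor c i j) = a i n) sequentially"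
      using eventually_gt_at_top[of i] by eventually_elim (simp add: a_def)
  qed
  have bound: "norm (a i n) \<le> B * C * exp (- (t / 2) * c i)" for i n
  proof (cases "i < n")
    case True
    have "norm (a i n) \<le> (B * exp (- t * c i)) * (C * exp (t / 2 * c i))"
      unfolding a_def using True w_le[OF True] C \<open>0 \<le> B\<close>
      by (simp add: abs_mult) (intro mult_mono; simp)
    also have "\<dots> = B * C * exp (- (t / 2) * c i)"
      by (simp add: mult_ac flip: exp_add)
    finally show ?thesis .
  qed (use C \<open>0 \<le> B\<close> in \<open>simp add: a_def\<close>)
  have "summable (\<lambda>i. B * C * exp (- (t / 2) * c i))"
    using summable_exp_rates[of "t / 2"] assms(1) by (intro summable_mult) simp
  from tannerys_theorem[where F = sequentially, OF lim _ this]
  have "summable (\<lambda>i. norm (limit_term c t i))"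
    and "(\<lambda>n. \<Sum>i. a i n) \<longlonglongrightarrow> (\<Sum>i. limit_term c t i)"
    using bound by (simp_all add: eventually_mono[OF eventually_True])
  then show "summable (\<lambda>i. \<bar>limit_term c t i\<bar>)"
    by simp
  have "(\<Sum>i. a i n) = (\<Sum>i<n. w n i * (\<Prod>j<n. limit_factor c i j))" for n
    by (subst suminf_finite[of "{..<n}"]) (auto simp: a_def)
  then show "(\<lambda>n. \<Sum>i<n. w n i * (\<Prod>j<n. limit_factor c i j)) \<longlonglongrightarrow> (\<Sum>i. limit_term c t i)"
    using \<open>(\<lambda>n. \<Sum>i. a i n) \<longlonglongrightarrow> _\<close> by simp
qed

lemma
  assumes "0 < t"
  shows summable_limit_term: "summable (\<lambda>i. \<bar>limit_term c t i\<bar>)"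
    and survival_cont_tendsto: "(\<lambda>n. survival_cont c n t) \<longlonglongrightarrow> (\<Sum>i. limit_term c t i)"
  using survival_tendsto[OF assms, of "\<lambda>n i. exp (- t * c i)" 1] by (simp_all add: survival_cont_def)

lemma c_at_top: "filterlim c at_top sequentially"
proof -
  have "(\<lambda>n. 1 / c n) \<longlonglongrightarrow> 0"
    by (rule summable_LIMSEQ_zero[OF c_summable])
  then have "filterlim (\<lambda>n. inverse (1 / c n)) at_top sequentially"
    using c_pos by (intro filterlim_inverse_at_top) auto
  then show ?thesis
    by simp
qed

lemma survival_tendsto_floor:
  assumes "0 < t"
  shows "(\<lambda>n. survival c (c n) n (nat \<lfloor>c n * t\<rfloor>)) \<longlonglongrightarrow> (\<Sum>i. limit_term c t i)"
  unfolding survival_def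
proof (rule survival_tendsto(2)[OF assms])
  show "(\<lambda>n. (1 - c i / c n) ^ nat \<lfloor>c n * t\<rfloor>) \<longlonglongrightarrow> exp (- t * c i)" for i
  proof -
    \<comment> \<open>The limit is taken along a real variable \<open>x\<close> and then composed
      with \<open>c\<close>, which tends to infinity. The logarithmic form agrees with the power
      once \<open>x > y\<close>.\<close>
    have "((\<lambda>x. (1 - y / x) ^ nat \<lfloor>x * t\<rfloor>) \<longlongrightarrow> exp (- t * y)) at_top" if "0 < y" for y
    proof (rule Lim_transform_eventually)
      show "((\<lambda>x. exp (real_of_int \<lfloor>x * t\<rfloor> * ln (1 - y / x))) \<longlongrightarrow> exp (- t * y)) at_top"
        using assms that by real_asymp
      have "eventually (\<lambda>x. y < x) at_top"
        by (rule eventually_gt_at_top)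
      then show "eventually (\<lambda>x. exp (real_of_int \<lfloor>x * t\<rfloor> * ln (1 - y / x))
          = (1 - y / x) ^ nat \<lfloor>x * t\<rfloor>) at_top"
      proof eventually_elim
        case (elim x)
        then have "0 < 1 - y / x" "real_of_int \<lfloor>x * t\<rfloor> = real (nat \<lfloor>x * t\<rfloor>)"
          using that assms by simp_all
        then show ?case
          by (simp add: exp_of_nat_mult)
      qed
    qed
    from filterlim_compose[OF this[OF c_pos[of i]] c_at_top] show ?thesis .
  qed
  fix n i :: nat
  assume "i < n"
  let ?q = "c i / c n" and ?m = "nat \<lfloor>c n * t\<rfloor>"
  have q: "0 < ?q" "?q \<le> 1"
    using \<open>i < n\<close> c_pos[of n] c_pos[of i] c_strict_mono by (auto simp: strict_mono_less less_imp_le)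
  \<comment> \<open>Rounding down loses less than one step, which costs at most a factor
    \<open>exp 1\<close> because \<open>?q \<le> 1\<close>; hence the constant
    \<open>B = exp 1\<close>.\<close>
  have "c n * t - 1 \<le> real ?m"
    using c_pos[of n] assms by linarith
  then have "(c n * t - 1) * ?q \<le> real ?m * ?q"
    using q by (intro mult_right_mono) auto
  moreover have "(c n * t - 1) * ?q = t * c i - ?q"
    using c_pos[of n] by (simp add: field_simps)
  ultimately have le: "- (real ?m * ?q) \<le> 1 + - t * c i"
    using q by simp
  have "\<bar>(1 - ?q) ^ ?m\<bar> = (1 - ?q) ^ ?m"
    using q by simp
  also have "\<dots> \<le> exp (- ?q) ^ ?m"
    using q exp_ge_add_one_self[of "- ?q"] by (intro power_mono) auto
  also have "\<dots> = exp (- (real ?m * ?q))"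
    by (simp flip: exp_of_nat_mult)
  also have "\<dots> \<le> exp 1 * exp (- t * c i)"
    using le by (simp flip: exp_add)
  finally show "\<bar>(1 - ?q) ^ ?m\<bar> \<le> exp 1 * exp (- t * c i)" .
qed

text \<open>Time \<open>t\<close> is compared with time 1, where the series converges absolutely:
  for \<open>i > n\<close> and \<open>t \<ge> 1\<close> the extra factor
  \<open>exp (- (t - 1) * c i)\<close> is at most \<open>exp (- (t - 1) * c (Suc n))\<close>. The
  tail is thus of order \<open>exp (- t * c (Suc n))\<close>, and
  \<open>c n < c (Suc n)\<close>.\<close>

lemma limit_term_tail:
  "(\<lambda>t. \<Sum>i. limit_term c t (i + Suc n)) \<in> o[at_top](\<lambda>t. exp (- t * c n))"
proof -
  have shift: "limit_term c t i = exp (- (t - 1) * c i) * limit_term c 1 i" for t i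
    by (simp add: limit_term_def algebra_simps flip: exp_add mult.assoc)
  have summable_shift: "summable (\<lambda>i. \<bar>limit_term c 1 (i + Suc n)\<bar>)"
    using summable_limit_term[of 1] by (intro summable_ignore_initial_segment) simp
  let ?B = "exp (c (Suc n)) * (\<Sum>i. \<bar>limit_term c 1 (i + Suc n)\<bar>)"
  have "\<bar>\<Sum>i. limit_term c t (i + Suc n)\<bar> \<le> ?B * \<bar>exp (- t * c (Suc n))\<bar>" if "1 \<le> t" for t
  proof -
    have le: "\<bar>limit_term c t (i + Suc n)\<bar>
        \<le> exp (- (t - 1) * c (Suc n)) * \<bar>limit_term c 1 (i + Suc n)\<bar>" for i
    proof -
      have "c (Suc n) \<le> c (i + Suc n)"
        using c_strict_mono by (simp add: strict_mono_less_eq)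
      then have "- (t - 1) * c (i + Suc n) \<le> - (t - 1) * c (Suc n)"
        using that by (intro mult_left_mono_neg) auto
      then show ?thesis
        unfolding shift[of t] by (simp only: abs_mult abs_exp_cancel) (intro mult_right_mono; simp)
    qed
    have "norm (\<Sum>i. limit_term c t (i + Suc n))
        \<le> (\<Sum>i. exp (- (t - 1) * c (Suc n)) * \<bar>limit_term c 1 (i + Suc n)\<bar>)"
      using le by (intro norm_suminf_le summable_mult summable_shift) simp
    also have "\<dots> = ?B * exp (- t * c (Suc n))"
      by (subst suminf_mult[OF summable_shift]) (simp add: algebra_simps flip: exp_add mult.assoc)
    finally show ?thesis
      by simp
  qed
  then have "(\<lambda>t. \<Sum>i. limit_term c t (i + Suc n)) \<in> O[at_top](\<lambda>t. exp (- t * c (Suc n)))"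
    by (intro bigoI[of _ ?B] eventually_mono[OF eventually_ge_at_top[of 1]]) simp
  moreover have "(\<lambda>t. exp (- t * c (Suc n))) \<in> o[at_top](\<lambda>t. exp (- t * c n))"
  proof -
    have "0 < c n" "c n < c (Suc n)"
      using c_pos c_strict_mono by (simp_all add: strict_mono_less)
    then show ?thesis
      by real_asymp
  qed
  ultimately show ?thesis
    by (rule landau_o.big_small_trans)
qed

end

text \<open>Convergence of the products and of the series is part of the conclusion, because the
  infinite product and sum denote some value even when they diverge.\<close>

theorem proposition3p21:
  fixes S :: "nat \<Rightarrow> 'a set"
    and up down :: "nat \<Rightarrow> 'a \<Rightarrow> 'a \<Rightarrow> real"
    and e :: 'a
    and \<beta> c :: "nat \<Rightarrow> real"
  assumes "\<And>n. finite (S n)"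
    and "disjoint_family S"
    and "S 0 = {e}"
    and "\<And>n. stochastic_matrix (S n) (S (Suc n)) (up n)"
    and "\<And>n. n \<ge> 1 \<Longrightarrow> stochastic_matrix (S n) (S (n - 1)) (down n)"
    and "\<And>n. n \<ge> 1 \<Longrightarrow> 0 < \<beta> n \<and> \<beta> n < 1"
    and "\<And>n r s. n \<ge> 1 \<Longrightarrow> r \<in> S n \<Longrightarrow> s \<in> S n \<Longrightarrow>
           mat_mul (S (Suc n)) (up n) (down (Suc n)) r s
             = \<beta> n * mat_mul (S (n - 1)) (down n) (up (n - 1)) r s + (1 - \<beta> n) * id_mat r s"
    and "\<And>n. 0 < c n"
    and "\<And>n. n \<ge> 1 \<Longrightarrow> c (n - 1) / c n = \<beta> n"
    and "\<And>n. n \<ge> 1 \<Longrightarrow> \<exists>r\<in>S n. \<exists>s\<in>S n. stat_dist S up e n s > 0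
           \<and> (\<exists>m. mat_pow (S n) (trans_mat S up down n) m r s > 0)
           \<and> n = (LEAST m. mat_pow (S n) (trans_mat S up down n) m r s > 0)"
    and "summable (\<lambda>n. 1 / c n)"
    and "\<not> bounded (range (\<lambda>n. c (Suc n) - c n))"
    and "incseq (\<lambda>n. c (Suc n) - c n)"
  shows "(\<forall>i. convergent_prod (limit_factor c i))
    \<and> (\<forall>t>0. summable (limit_term c t)
         \<and> (\<lambda>n. sep_dist S up down e n (nat \<lfloor>c n * t\<rfloor>)) \<longlonglongrightarrow> (\<Sum>i. limit_term c t i)
         \<and> (\<lambda>n. sep_dist_cont S up down e c n t) \<longlonglongrightarrow> (\<Sum>i. limit_term c t i))
    \<and> (\<forall>n. (\<lambda>t. \<Sum>i. limit_term c t (i + Suc n)) \<in> o[at_top](\<lambda>t. exp (- t * c n)))"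
proof -
  interpret chain: up_down_chain S up down e \<beta> c
    by unfold_locales (use assms in auto)
  interpret convex_rates c
    by unfold_locales (use assms chain.c_strict_mono in auto)
  have extremal: "\<exists>r s. r \<in> S n \<and> s \<in> S n \<and> stat_dist S up e n s > 0
      \<and> (\<forall>m<n. mat_pow (S n) (trans_mat S up down n) m r s = 0)" if n: "n \<ge> 1" for n
  proof -
    obtain r s where rs: "r \<in> S n" "s \<in> S n" "stat_dist S up e n s > 0"
      and least: "n = (LEAST m. mat_pow (S n) (trans_mat S up down n) m r s > 0)"
      using assms(10)[OF n] by blast
    \<comment> \<open>Below the least \<open>m\<close> with a positive entry the entries are not
      positive, and stochastic matrices have no negative ones.\<close>
    have "mat_pow (S n) (trans_mat S up down n) m r s = 0" if "m < n" for m
      using not_less_Least[OF order.strict_trans2[OF that eq_refl[OF least]]]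
        stochastic_matrix_nonneg[OF chain.stochastic_Tpow rs(1,2), of m] by linarith
    then show ?thesis
      using rs by blast
  qed
  have sep: "(\<lambda>n. sep_dist S up down e n (nat \<lfloor>c n * t\<rfloor>)) \<longlonglongrightarrow> (\<Sum>i. limit_term c t i)"
    if "0 < t" for t
  proof (rule Lim_transform_eventually[OF survival_tendsto_floor[OF that]])
    \<comment> \<open>Extremal pairs are given for \<open>n \<ge> 1\<close>, so the identity is
      stated eventually, which suffices for the limit.\<close>
    show "eventually (\<lambda>n. survival c (c n) n (nat \<lfloor>c n * t\<rfloor>)
        = sep_dist S up down e n (nat \<lfloor>c n * t\<rfloor>)) sequentially"
      using eventually_ge_at_top[of 1]
    proof eventually_elim
      case (elim n)
      from extremal[OF elim] show ?case
        by (auto intro: chain.sep_dist_eq_survival[symmetric])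
    qed
  qed
  have cont: "(\<lambda>n. sep_dist_cont S up down e c n t) \<longlonglongrightarrow> (\<Sum>i. limit_term c t i)"
    if "0 < t" for t
  proof (rule Lim_transform_eventually[OF survival_cont_tendsto[OF that]])
    show "eventually (\<lambda>n. survival_cont c n t = sep_dist_cont S up down e c n t) sequentially"
      using eventually_ge_at_top[of 1]
    proof eventually_elim
      case (elim n)
      from extremal[OF elim] that show ?case
        by (auto intro: chain.sep_dist_cont_eq_survival_cont[symmetric])
    qed
  qed
  show ?thesis
    by (intro conjI allI impI convergent_prod_limit_factor sep cont limit_term_tail
        summable_rabs_cancel[OF summable_limit_term])
qed

end
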